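(* Suppose the provider routes first to model 1 (i.e. $i=1$) with cascade probability $s\in[0,1]$. Then the user best response $q^*(1,s)$ (a maximizer of $U_1(s,q)$ over $q\in[0,1]$) is as follows. 1. If $\xi_1,\xi_2\ge 0$, then $q^*(1,s)=0$ for all $s$. 2. If $\xi_1,\xi_2\le 0$, then $q^*(1,s)=1$ for all $s$. 3. If $\xi_1<0<\xi_2$, let $s_0:=-\xi_1/(\xi_2/p_2-\xi_1)$. Then $q^*(1,s)=\mathbf 1\{s<s_0\}$. 4. If $\xi_1>0>\xi_2$, let $$F(s,q):=\xi_1(1-s)\bigl(p_2+(1-p_2)q\bigr)^2+\xi_2 s\bigl(1-(1-p_1)(1-p_2)(1-s)(1-q)^2\bigr).$$ Then $F(s,0)=0$ has a unique root $s_L\in[0,1]$. Let $s_H:=\xi_1/(\xi_1-\xi_2)$. For every $s\in(s_L,s_H)$ the quadratic equation $F(s,q)=0$ in $q$ has a unique root $q^\dagger(s)\in[0,1]$, and $$q^*(1,s)=\begin{cases}0 & \text{if } s\le s_L,\\ q^\dagger(s) & \text{if } s_L<s<s_H,\\ 1 & \text{if } s\ge s_H.\end{cases}$$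
   Context: Two models $M_1,M_2$ have success probabilities $0<p_1<p_2<1$, user latencies $t_1<t_2$ in $[0,1]$, and provider costs $c_1<c_2$ in $[0,1]$. A success is worth $V>0$ to the user, and $\xi_i:=Vp_i-t_i$ for $i\in\{1,2\}$. A provider policy is a pair $(i,s)$ with $i\in\{1,2\}$ the initial model and $s\in[0,1]$ the probability of cascading from $M_1$ to $M_2$ after a failure of $M_1$. The user chooses an abandonment probability $q\in[0,1]$, the probability of leaving after a failed attempt. Let $\alpha(q):=(1-p_1)(1-q)$ and $\beta(q):=\frac{1}{p_2+(1-p_2)q}$. When $i=1$, the success probability is $S_1(s,q)=\frac{p_1+\alpha(q)\beta(q)p_2 s}{1-\alpha(q)(1-s)}$, the expected total latency is $L_1(s,q)=\frac{t_1+\alpha(q)\beta(q)t_2 s}{1-\alpha(q)(1-s)}$, and the user's expected utility is $U_1(s,q):=V S_1(s,q)-L_1(s,q)$. The user best response $q^*(1,s)$ is a maximizer of $U_1(s,q)$ over $q\in[0,1]$; where the maximizer is not unique, the statement asserts that the displayed value is a maximizer. *)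

theory Defs
  imports Complex_Main
begin

(* Expected net value of one attempt with a model of success probability p and user latency t. *)
definition xi :: "real \<Rightarrow> real \<Rightarrow> real \<Rightarrow> real" where
  "xi V p t = V * p - t"

(* Probability that M1 fails and the user nevertheless stays. *)
definition alpha :: "real \<Rightarrow> real \<Rightarrow> real" where
  "alpha p1 q = (1 - p1) * (1 - q)"

(* Expected number of attempts once the query has reached M2:
   p2 + (1 - p2) * q is the probability that an attempt with M2 is the last one. *)
definition beta :: "real \<Rightarrow> real \<Rightarrow> real" where
  "beta p2 q = 1 / (p2 + (1 - p2) * q)"

definition S1 :: "real \<Rightarrow> real \<Rightarrow> real \<Rightarrow> real \<Rightarrow> real" where
  "S1 p1 p2 s q =
     (p1 + alpha p1 q * beta p2 q * p2 * s) / (1 - alpha p1 q * (1 - s))"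

definition L1 :: "real \<Rightarrow> real \<Rightarrow> real \<Rightarrow> real \<Rightarrow> real \<Rightarrow> real \<Rightarrow> real" where
  "L1 p1 p2 t1 t2 s q =
     (t1 + alpha p1 q * beta p2 q * t2 * s) / (1 - alpha p1 q * (1 - s))"

definition U1 :: "real \<Rightarrow> real \<Rightarrow> real \<Rightarrow> real \<Rightarrow> real \<Rightarrow> real \<Rightarrow> real \<Rightarrow> real" where
  "U1 V p1 p2 t1 t2 s q = V * S1 p1 p2 s q - L1 p1 p2 t1 t2 s q"

(* The maximizer need not be unique, so q*(1,s) is a relation between s and q
   rather than a function of s. *)
definition user_best_response1 ::
    "real \<Rightarrow> real \<Rightarrow> real \<Rightarrow> real \<Rightarrow> real \<Rightarrow> real \<Rightarrow> real \<Rightarrow> bool" where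
  "user_best_response1 V p1 p2 t1 t2 s q \<longleftrightarrow>
     is_arg_max (U1 V p1 p2 t1 t2 s) (\<lambda>q. q \<in> {0..1}) q"

definition F :: "real \<Rightarrow> real \<Rightarrow> real \<Rightarrow> real \<Rightarrow> real \<Rightarrow> real \<Rightarrow> real \<Rightarrow> real" where
  "F V p1 p2 t1 t2 s q =
     xi V p1 t1 * (1 - s) * (p2 + (1 - p2) * q)^2
     + xi V p2 t2 * s * (1 - (1 - p1) * (1 - p2) * (1 - s) * (1 - q)^2)"

end

theory Submission
  imports Defs
begin

text \<open>
  In the variable \<open>y = 1 - q\<close>, put \<open>m = 1 - p2\<close>, \<open>k = (1 - p1) * (1 - s)\<close>, \<open>A = xi1 * (1 - s)\<close>
  and \<open>B = xi2 * s\<close>. No calculus is needed: with the bilinear polarization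
  \<open>G(y, z) = A * (1 - m * y) * (1 - m * z) + B * (1 - m * k * y * z)\<close> of \<open>F\<close>, the difference
  \<open>U1(y) - U1(z)\<close> is a positive multiple of \<open>(y - z) * G(y, z)\<close>. Hence \<open>y\<close> is a best response
  iff \<open>(y - z) * G(y, z) \<ge> 0\<close> for all \<open>z\<close>, and since \<open>G(y, z)\<close> is affine in \<open>z\<close> its sign is
  controlled by few values. If \<open>F\<close> vanishes at \<open>y\<close>, i.e. \<open>G(y, y) = 0\<close>, and \<open>B < 0\<close>, then
  \<open>G(y, z)\<close> is a positive multiple of \<open>y - z\<close>; this gives optimality of \<open>y\<close> and, by the symmetry
  of \<open>G\<close>, uniqueness of the root.
\<close>

section \<open>Polarization of \<open>F\<close>\<close>

definition polar :: "real \<Rightarrow> real \<Rightarrow> real \<Rightarrow> real \<Rightarrow> real \<Rightarrow> real \<Rightarrow> real" where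
  "polar A B m k y z = A * (1 - m * y) * (1 - m * z) + B * (1 - m * k * y * z)"

lemma polar_commute: "polar A B m k y z = polar A B m k z y"
  by (simp add: polar_def algebra_simps)

lemma F_eq_polar:
  "F V p1 p2 t1 t2 s q =
     polar (xi V p1 t1 * (1 - s)) (xi V p2 t2 * s) (1 - p2) ((1 - p1) * (1 - s)) (1 - q) (1 - q)"
  by (simp add: F_def polar_def algebra_simps power2_eq_square)

section \<open>Utility differences\<close>

lemma mult_less_one:
  fixes x y :: real
  assumes "0 \<le> x" "x < 1" "0 \<le> y" "y \<le> 1"
  shows "x * y < 1"
  using mult_left_le[of y x] assms by linarith

lemma U1_eq:
  fixes y :: real
  assumes "0 < p1" "p1 < 1" "0 < p2" "p2 < 1" "s \<in> {0..1}" "y \<in> {0..1}"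
  defines "m \<equiv> 1 - p2" and "k \<equiv> (1 - p1) * (1 - s)"
  shows "U1 V p1 p2 t1 t2 s (1 - y) =
    (xi V p1 t1 * (1 - m * y) + (1 - p1) * s * xi V p2 t2 * y) / ((1 - m * y) * (1 - k * y))"
    and "1 - m * y > 0" and "1 - k * y > 0"
proof -
  show m: "1 - m * y > 0"
    using mult_less_one[of m y] assms by auto
  have "k < 1"
    using mult_less_one[of "1 - p1" "1 - s"] assms by auto
  then show k: "1 - k * y > 0"
    using mult_less_one[of k y] assms by auto
  have e1: "p2 + (1 - p2) * (1 - y) = 1 - m * y"
    and e2: "1 - alpha p1 (1 - y) * (1 - s) = 1 - k * y"
    by (simp_all add: m_def k_def alpha_def algebra_simps)
  have "U1 V p1 p2 t1 t2 s (1 - y) =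
      (V * (p1 + (1 - p1) * y * (1 / (1 - m * y)) * p2 * s)
       - (t1 + (1 - p1) * y * (1 / (1 - m * y)) * t2 * s)) / (1 - k * y)"
    unfolding U1_def S1_def L1_def beta_def e1 e2 by (simp add: alpha_def diff_divide_distrib)
  also have "V * (p1 + (1 - p1) * y * (1 / (1 - m * y)) * p2 * s)
       - (t1 + (1 - p1) * y * (1 / (1 - m * y)) * t2 * s)
      = xi V p1 t1 + (1 - p1) * s * xi V p2 t2 * y / (1 - m * y)"
    by (simp add: xi_def algebra_simps diff_divide_distrib add_divide_distrib)
  also have "\<dots> = (xi V p1 t1 * (1 - m * y) + (1 - p1) * s * xi V p2 t2 * y) / (1 - m * y)"
    using m by (simp add: add_divide_distrib)
  finally show "U1 V p1 p2 t1 t2 s (1 - y) =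
    (xi V p1 t1 * (1 - m * y) + (1 - p1) * s * xi V p2 t2 * y) / ((1 - m * y) * (1 - k * y))"
    by simp
qed

lemma U1_diff:
  fixes y z :: real
  assumes p: "0 < p1" "p1 < 1" "0 < p2" "p2 < 1" and s: "s \<in> {0..1}"
    and y: "y \<in> {0..1}" and z: "z \<in> {0..1}"
  defines "m \<equiv> 1 - p2" and "k \<equiv> (1 - p1) * (1 - s)"
  shows "U1 V p1 p2 t1 t2 s (1 - y) - U1 V p1 p2 t1 t2 s (1 - z) =
    (1 - p1) * ((y - z) * polar (xi V p1 t1 * (1 - s)) (xi V p2 t2 * s) m k y z)
    / (((1 - m * y) * (1 - k * y)) * ((1 - m * z) * (1 - k * z)))"
proof -
  note Y = U1_eq[OF p s y, folded m_def k_def] and Z = U1_eq[OF p s z, folded m_def k_def]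
  let ?N = "\<lambda>y. xi V p1 t1 * (1 - m * y) + (1 - p1) * s * xi V p2 t2 * y"
  \<comment> \<open>The \<open>xi V p1 t1\<close> parts share the factor
    \<open>(1 - m * y) * (1 - m * z)\<close>, leaving
    \<open>(1 - k * z) - (1 - k * y) = k * (y - z)\<close>; in the other parts the terms in
    \<open>(m + k) * y * z\<close> cancel.\<close>
  have "?N y * ((1 - m * z) * (1 - k * z)) - ?N z * ((1 - m * y) * (1 - k * y)) =
      (y - z) * (xi V p1 t1 * k * (1 - m * y) * (1 - m * z)
        + (1 - p1) * s * xi V p2 t2 * (1 - m * k * y * z))"
    by algebra
  \<comment> \<open>Pulling out only \<open>1 - p1\<close>, and not all of \<open>k\<close>, keeps
    \<open>s = 1\<close> within the same formula.\<close>
  also have "\<dots> = (1 - p1) * ((y - z) * polar (xi V p1 t1 * (1 - s)) (xi V p2 t2 * s) m k y z)"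
    unfolding polar_def k_def by algebra
  finally show ?thesis
    unfolding Y(1) Z(1) using Y(2,3) Z(2,3) by (subst diff_frac_eq) auto
qed

lemma best_response_if_polar:
  fixes y :: real
  assumes p: "0 < p1" "p1 < 1" "0 < p2" "p2 < 1" and s: "s \<in> {0..1}" and y: "y \<in> {0..1}"
    and G: "\<And>z. z \<in> {0..1} \<Longrightarrow>
      (y - z) * polar (xi V p1 t1 * (1 - s)) (xi V p2 t2 * s) (1 - p2) ((1 - p1) * (1 - s)) y z \<ge> 0"
  shows "user_best_response1 V p1 p2 t1 t2 s (1 - y)"
  unfolding user_best_response1_def is_arg_max_linorder
proof (intro conjI allI impI)
  fix q :: real assume "q \<in> {0..1}"
  then have z: "1 - q \<in> {0..1}" by auto
  have "U1 V p1 p2 t1 t2 s (1 - y) - U1 V p1 p2 t1 t2 s (1 - (1 - q)) \<ge> 0"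
    unfolding U1_diff[OF p s y z]
    using G[OF z] p U1_eq(2,3)[OF p s y] U1_eq(2,3)[OF p s z]
    by (intro divide_nonneg_pos mult_nonneg_nonneg[of "1 - p1"] mult_pos_pos) auto
  then show "U1 V p1 p2 t1 t2 s q \<le> U1 V p1 p2 t1 t2 s (1 - y)" by simp
qed (use y in auto)

section \<open>Signs of the polarization\<close>

lemma polar_one_nonneg:
  assumes z: "z \<in> {0..1}" and zero: "A * (1 - m) + B \<ge> 0"
    and one: "polar A B m k 1 1 \<ge> 0"
  shows "polar A B m k 1 z \<ge> 0"
proof -
  \<comment> \<open>Affine in \<open>z\<close>: interpolate between the values at
    \<open>z = 0\<close> and \<open>z = 1\<close>.\<close>
  have "polar A B m k 1 z = (1 - z) * (A * (1 - m) + B) + z * polar A B m k 1 1"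
    by (simp add: polar_def algebra_simps)
  then show ?thesis using z zero one by simp
qed

lemma polar_zero_nonpos:
  assumes z: "z \<in> {0..1}" and zero: "A + B \<le> 0" and one: "A * (1 - m) + B \<le> 0"
  shows "polar A B m k 0 z \<le> 0"
proof -
  have "polar A B m k 0 z = (1 - z) * (A + B) + z * (A * (1 - m) + B)"
    by (simp add: polar_def algebra_simps)
  moreover have "(1 - z) * (A + B) \<le> 0" "z * (A * (1 - m) + B) \<le> 0"
    using z zero one by (auto intro!: mult_nonneg_nonpos)
  ultimately show ?thesis by simp
qed

text \<open>Subtracting \<open>(1 - m * z) * polar A B m k y y\<close> cancels \<open>A\<close>; the
  remaining multiple of \<open>B\<close> vanishes at \<open>z = y\<close>, whence the factor
  \<open>y - z\<close>.\<close>

lemma polar_at_root: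
  assumes "polar A B m k y y = 0"
  shows "(1 - m * y) * polar A B m k y z = - B * m * (1 - k * y) * (y - z)"
proof -
  have "(1 - m * y) * polar A B m k y z = (1 - m * z) * polar A B m k y y
      - B * m * (1 - k * y) * (y - z)"
    unfolding polar_def by algebra
  then show ?thesis using assms by simp
qed

lemma polar_at_root_sign:
  assumes root: "polar A B m k y y = 0" and B: "B < 0"
    and m: "0 < m" "m < 1" and k: "0 \<le> k" "k < 1" and y: "y \<in> {0..1}"
  shows "(y - z) * polar A B m k y z \<ge> 0"
    and "y \<noteq> z \<Longrightarrow> (y - z) * polar A B m k y z > 0"
proof -
  have d: "1 - m * y > 0" "1 - k * y > 0"
    using mult_less_one[of m y] mult_less_one[of k y] m k y by auto
  define c where "c = - B * m * (1 - k * y) / (1 - m * y)"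
  have "c > 0" unfolding c_def using B m d by (intro divide_pos_pos mult_pos_pos) auto
  have "polar A B m k y z = c * (y - z)"
    using polar_at_root[OF root, of z] d by (simp add: c_def field_simps)
  then have e: "(y - z) * polar A B m k y z = c * (y - z)^2"
    by (simp add: power2_eq_square)
  show "(y - z) * polar A B m k y z \<ge> 0" using e \<open>c > 0\<close> by simp
  show "y \<noteq> z \<Longrightarrow> (y - z) * polar A B m k y z > 0" using e \<open>c > 0\<close> by simp
qed

text \<open>In terms of utility, two distinct roots would each be strictly better than the
  other.\<close>

lemma polar_root_unique:
  assumes "polar A B m k y y = 0" "polar A B m k z z = 0" "B < 0"
    and "0 < m" "m < 1" "0 \<le> k" "k < 1" "y \<in> {0..1}" "z \<in> {0..1}"
  shows "y = z"
proof (rule ccontr)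
  assume "y \<noteq> z"
  then have "(y - z) * polar A B m k y z > 0" "(z - y) * polar A B m k z y > 0"
    using assms polar_at_root_sign(2) by metis+
  then show False
    by (metis polar_commute minus_diff_eq mult_minus_left neg_0_less_iff_less less_asym)
qed

text \<open>With \<open>r = (1 - p1) * (1 - p2)\<close>, the second summand at \<open>q = 0\<close>
  is \<open>xi V p2 t2\<close> times the increasing \<open>s * (1 - r + r * s)\<close>, so both
  summands decrease. This makes \<open>sL\<close> unique and fixes the sign of \<open>F\<close> at
  \<open>q = 0\<close> on either side of it.\<close>

lemma F_zero_strict_antimono:
  assumes a: "xi V p1 t1 > 0" and b: "xi V p2 t2 < 0"
    and p: "0 < p1" "p1 < 1" "0 < p2" "p2 < 1" and s: "0 \<le> s" "s < s'"
  shows "F V p1 p2 t1 t2 s' 0 < F V p1 p2 t1 t2 s 0"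
proof -
  let ?r = "(1 - p1) * (1 - p2)"
  have r: "0 < ?r" "?r < 1" using p mult_less_one[of "1 - p1" "1 - p2"] by auto
  have "F V p1 p2 t1 t2 s' 0 - F V p1 p2 t1 t2 s 0 =
      - ((s' - s) * (xi V p1 t1 * p2^2 - xi V p2 t2 * (1 - ?r + ?r * (s + s'))))"
    by (simp add: F_def algebra_simps power2_eq_square)
  moreover have "xi V p1 t1 * p2^2 > 0" using a p by simp
  moreover have "1 - ?r + ?r * (s + s') > 0"
    using r s by (intro add_pos_nonneg mult_nonneg_nonneg[of ?r]) auto
  then have "xi V p2 t2 * (1 - ?r + ?r * (s + s')) < 0" using b by (simp add: mult_neg_pos)
  ultimately show ?thesis using s
    by (smt (verit) mult_pos_pos)
qed

theorem theorem2:
  fixes V p1 p2 t1 t2 c1 c2 :: real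
  assumes "0 < p1" and "p1 < p2" and "p2 < 1"
    and "0 \<le> t1" and "t1 < t2" and "t2 \<le> 1"
    and "0 \<le> c1" and "c1 < c2" and "c2 \<le> 1"
    and "V > 0"
  shows
    "(xi V p1 t1 \<ge> 0 \<and> xi V p2 t2 \<ge> 0 \<longrightarrow>
        (\<forall>s\<in>{0..1}. user_best_response1 V p1 p2 t1 t2 s 0)) \<and>
     (xi V p1 t1 \<le> 0 \<and> xi V p2 t2 \<le> 0 \<longrightarrow>
        (\<forall>s\<in>{0..1}. user_best_response1 V p1 p2 t1 t2 s 1)) \<and>
     (xi V p1 t1 < 0 \<and> 0 < xi V p2 t2 \<longrightarrow>
        (let s0 = - xi V p1 t1 / (xi V p2 t2 / p2 - xi V p1 t1) in
          \<forall>s\<in>{0..1}. user_best_response1 V p1 p2 t1 t2 s (if s < s0 then 1 else 0))) \<and>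
     (xi V p1 t1 > 0 \<and> 0 > xi V p2 t2 \<longrightarrow>
        (\<exists>!sL. sL \<in> {0..1} \<and> F V p1 p2 t1 t2 sL 0 = 0) \<and>
        (\<forall>sL\<in>{0..1}. F V p1 p2 t1 t2 sL 0 = 0 \<longrightarrow>
          (let sH = xi V p1 t1 / (xi V p1 t1 - xi V p2 t2) in
            (\<forall>s\<in>{sL<..<sH}.
               (\<exists>!q. q \<in> {0..1} \<and> F V p1 p2 t1 t2 s q = 0) \<and>
               (\<forall>qd\<in>{0..1}. F V p1 p2 t1 t2 s qd = 0 \<longrightarrow>
                  user_best_response1 V p1 p2 t1 t2 s qd)) \<and>
            (\<forall>s\<in>{0..1}. s \<le> sL \<longrightarrow> user_best_response1 V p1 p2 t1 t2 s 0) \<and>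
            (\<forall>s\<in>{0..1}. s \<ge> sH \<longrightarrow> user_best_response1 V p1 p2 t1 t2 s 1))))"
proof -
  define a b m where "a = xi V p1 t1" and "b = xi V p2 t2" and "m = 1 - p2"
  have p: "0 < p1" "p1 < 1" "0 < p2" "p2 < 1" using assms by auto
  have m: "0 < m" "m < 1" and pm: "1 - m = p2" using p by (auto simp: m_def)
  let ?k = "\<lambda>s. (1 - p1) * (1 - s)"
  let ?G = "\<lambda>s. polar (a * (1 - s)) (b * s) m (?k s)"
  let ?BR = "user_best_response1 V p1 p2 t1 t2"
  have k: "0 \<le> ?k s" "?k s < 1" if "s \<in> {0..1}" for s
    using that p mult_less_one[of "1 - p1" "1 - s"] by auto
  have F: "F V p1 p2 t1 t2 s q = ?G s (1 - q) (1 - q)" for s q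
    by (simp add: F_eq_polar a_def b_def m_def)
  have BR: "?BR s (1 - y)"
    if "s \<in> {0..1}" "y \<in> {0..1}" "\<And>z. z \<in> {0..1} \<Longrightarrow> (y - z) * ?G s y z \<ge> 0" for s y
    using best_response_if_polar[OF p that(1,2)] that(3) by (simp add: a_def b_def m_def)
  \<comment> \<open>\<open>q = 0\<close> is \<open>y = 1\<close>, so \<open>y - z\<close> is
    nonnegative and only the sign of \<open>G(1, z)\<close> matters; the last two hypotheses are its
    values at \<open>z = 0\<close> and \<open>z = 1\<close>. For \<open>BR1\<close>,
    \<open>y = 0\<close> reverses both signs.\<close>
  have BR0: "?BR s 0"
    if "s \<in> {0..1}" "a * (1 - s) * p2 + b * s \<ge> 0" "?G s 1 1 \<ge> 0" for s
    using BR[of s 1] polar_one_nonneg that by (simp add: pm)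
  have BR1: "?BR s 1"
    if "s \<in> {0..1}" "a * (1 - s) + b * s \<le> 0" "a * (1 - s) * p2 + b * s \<le> 0" for s
    using BR[of s 0] polar_zero_nonpos that by (simp add: pm mult_nonneg_nonpos)
  have G11: "?G s 1 1 = a * (1 - s) * p2 * p2 + b * s * (1 - m * ?k s)" for s
    by (simp add: polar_def pm)
  have mk: "m * ?k s \<le> m" if "s \<in> {0..1}" for s
    using m k[OF that] by (intro mult_left_le) auto

  have 1: "?BR s 0" if "a \<ge> 0" "b \<ge> 0" "s \<in> {0..1}" for s
  proof (rule BR0)
    have "1 - m * ?k s \<ge> 0" using mk[OF that(3)] m by linarith
    then show "?G s 1 1 \<ge> 0"
      unfolding G11 using that p by (intro add_nonneg_nonneg mult_nonneg_nonneg) auto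
  qed (use that p in auto)
  have 2: "?BR s 1" if "a \<le> 0" "b \<le> 0" "s \<in> {0..1}" for s
    using that p by (intro BR1) (auto intro!: add_nonpos_nonpos mult_nonpos_nonneg)
  have 3: "?BR s (if s < - a / (b / p2 - a) then 1 else 0)"
    if "a < 0" "0 < b" and s: "s \<in> {0..1}" for s
  proof -
    have "b / p2 - a > 0" using that p by (smt (verit) divide_pos_pos)
    then have "s < - a / (b / p2 - a) \<longleftrightarrow> s * (b / p2 - a) < - a"
      by (rule pos_less_divide_eq)
    \<comment> \<open>The left side is \<open>G(1, 0)\<close>, whose sign compares
      \<open>q = 0\<close> with \<open>q = 1\<close>: at \<open>s0\<close> the user is indifferent
      between the two endpoints.\<close>
    also have "\<dots> \<longleftrightarrow> a * (1 - s) * p2 + b * s < 0"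
      using p by (simp add: field_simps)
    finally have iff: "s < - a / (b / p2 - a) \<longleftrightarrow> a * (1 - s) * p2 + b * s < 0" .
    show ?thesis
    proof (cases "s < - a / (b / p2 - a)")
      case True
      \<comment> \<open>That is, \<open>G(0, 0) <= G(0, 1)\<close>, so negativity of the latter
        gives both conditions of \<open>BR1\<close>.\<close>
      have "a * (1 - s) \<le> a * (1 - s) * p2"
        using that p mult_left_mono_neg[of p2 1 "a * (1 - s)"]
        by (simp add: mult_nonpos_nonneg)
      then show ?thesis using True iff BR1[OF s] by auto
    next
      case False
      then have h: "a * (1 - s) * p2 + b * s \<ge> 0" using iff by simp
      \<comment> \<open>This is \<open>p2 * G(1, 0)\<close> plus a multiple of \<open>B\<close>,
        which is nonnegative here, so nonnegativity passes from \<open>G(1, 0)\<close> to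
        \<open>G(1, 1)\<close>.\<close>
      have "?G s 1 1 = (a * (1 - s) * p2 + b * s) * p2 + b * s * (m - m * ?k s)"
        unfolding G11 by (simp add: algebra_simps flip: pm)
      also have "\<dots> \<ge> 0"
      proof (rule add_nonneg_nonneg)
        show "(a * (1 - s) * p2 + b * s) * p2 \<ge> 0" by (rule mult_nonneg_nonneg[OF h]) (use p in simp)
        show "b * s * (m - m * ?k s) \<ge> 0"
          using that mk[OF s] by (intro mult_nonneg_nonneg) auto
      qed
      finally have "?BR s 0" by (rule BR0[OF s h])
      then show ?thesis using False by simp
    qed
  qed
  have 4: "(\<exists>!sL. sL \<in> {0..1} \<and> F V p1 p2 t1 t2 sL 0 = 0) \<and>
        (\<forall>sL\<in>{0..1}. F V p1 p2 t1 t2 sL 0 = 0 \<longrightarrow>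
          (let sH = a / (a - b) in
            (\<forall>s\<in>{sL<..<sH}.
               (\<exists>!q. q \<in> {0..1} \<and> F V p1 p2 t1 t2 s q = 0) \<and>
               (\<forall>qd\<in>{0..1}. F V p1 p2 t1 t2 s qd = 0 \<longrightarrow> ?BR s qd)) \<and>
            (\<forall>s\<in>{0..1}. s \<le> sL \<longrightarrow> ?BR s 0) \<and>
            (\<forall>s\<in>{0..1}. s \<ge> sH \<longrightarrow> ?BR s 1)))"
    if a: "a > 0" and b: "0 > b"
  proof (intro conjI ballI impI)
    note anti = F_zero_strict_antimono[OF a[unfolded a_def] b[unfolded b_def] p]
    \<comment> \<open>The end values are \<open>a * p2^2 > 0\<close> at \<open>s = 0\<close> and
      \<open>b < 0\<close> at \<open>s = 1\<close>.\<close>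
    have "\<exists>s\<ge>0. s \<le> 1 \<and> F V p1 p2 t1 t2 s 0 = 0"
    proof (rule IVT2')
      show "continuous_on {0..1} (\<lambda>s. F V p1 p2 t1 t2 s 0)"
        unfolding F_def by (intro continuous_intros)
    qed (use a b p in \<open>auto simp: F_def a_def b_def\<close>)
    then show "\<exists>!sL. sL \<in> {0..1} \<and> F V p1 p2 t1 t2 sL 0 = 0"
      using anti by (metis atLeastAtMost_iff less_irrefl linorder_neqE_linordered_idom)
  next
    fix sL :: real
    assume sL: "sL \<in> {0..1}" and root: "F V p1 p2 t1 t2 sL 0 = 0"
    note anti = F_zero_strict_antimono[OF a[unfolded a_def] b[unfolded b_def] p]
    define sH where "sH = a / (a - b)"
    \<comment> \<open>\<open>a * (1 - s) + b * s\<close> is \<open>F\<close> at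
      \<open>q = 1\<close>, so \<open>sH\<close> marks its sign change in \<open>s\<close>.\<close>
    have sH: "sH < 1" and lt: "s < sH \<longleftrightarrow> a * (1 - s) + b * s > 0" for s
      using a b by (auto simp: sH_def field_simps)
    have mid: "(\<exists>!q. q \<in> {0..1} \<and> F V p1 p2 t1 t2 s q = 0) \<and>
        (\<forall>qd\<in>{0..1}. F V p1 p2 t1 t2 s qd = 0 \<longrightarrow> ?BR s qd)"
      if s: "s \<in> {sL<..<sH}" for s
    proof (intro conjI ballI impI)
      \<comment> \<open>\<open>s > sL >= 0\<close> makes \<open>s\<close> positive, hence
        \<open>B\<close> strictly negative, as the root lemmas demand.\<close>
      have s01: "s \<in> {0..1}" and B: "b * s < 0" using s sL sH b by (auto simp: mult_neg_pos)
      have "\<exists>q\<ge>0. q \<le> 1 \<and> F V p1 p2 t1 t2 s q = 0"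
      \<comment> \<open>The two thresholds give opposite signs: beyond \<open>sL\<close> at
        \<open>q = 0\<close>, before \<open>sH\<close> at \<open>q = 1\<close>.\<close>
      proof (rule IVT')
        show "F V p1 p2 t1 t2 s 0 \<le> 0" using anti[of sL s] root s sL by simp
        show "0 \<le> F V p1 p2 t1 t2 s 1" using lt[of s] s by (simp add: F_def a_def b_def)
        show "continuous_on {0..1} (\<lambda>q. F V p1 p2 t1 t2 s q)"
          unfolding F_def by (intro continuous_intros)
      qed simp
      then obtain q where q: "q \<in> {0..1}" "F V p1 p2 t1 t2 s q = 0" by auto
      show "\<exists>!q. q \<in> {0..1} \<and> F V p1 p2 t1 t2 s q = 0"
      proof (rule ex1I)
        show "q \<in> {0..1} \<and> F V p1 p2 t1 t2 s q = 0" using q by blast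
        fix q' assume q': "q' \<in> {0..1} \<and> F V p1 p2 t1 t2 s q' = 0"
        have "1 - q' = 1 - q"
        proof (rule polar_root_unique[OF _ _ B m k[OF s01]])
          show "?G s (1 - q') (1 - q') = 0" "?G s (1 - q) (1 - q) = 0"
            using q q' by (simp_all only: F)
        qed (use q q' in auto)
        then show "q' = q" by simp
      qed
      fix qd :: real
      assume qd: "qd \<in> {0..1}" and Fqd: "F V p1 p2 t1 t2 s qd = 0"
      have "(1 - qd - z) * ?G s (1 - qd) z \<ge> 0" for z
        by (rule polar_at_root_sign(1)[OF Fqd[unfolded F] B m k[OF s01]]) (use qd in auto)
      then show "?BR s qd" using BR[OF s01, of "1 - qd"] qd by auto
    qed
    have low: "?BR s 0" if s: "s \<in> {0..1}" and "s \<le> sL" for s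
    proof (rule BR0[OF s])
      have "F V p1 p2 t1 t2 s 0 \<ge> 0"
        using anti[of s sL] root s \<open>s \<le> sL\<close> by (cases "s = sL") auto
      then show G: "?G s 1 1 \<ge> 0" by (simp add: F)
      \<comment> \<open>The decomposition from case 3, now with \<open>B <= 0\<close>: nonnegativity
        passes the other way, from \<open>G(1, 1)\<close> to \<open>G(1, 0)\<close>.\<close>
      have "?G s 1 1 = (a * (1 - s) * p2 + b * s) * p2 + b * s * (m - m * ?k s)"
        unfolding G11 by (simp add: algebra_simps flip: pm)
      moreover have "b * s * (m - m * ?k s) \<le> 0"
        using b s mk[OF s] by (intro mult_nonpos_nonneg) auto
      ultimately have "(a * (1 - s) * p2 + b * s) * p2 \<ge> 0" using G by linarith
      then show "a * (1 - s) * p2 + b * s \<ge> 0" using p by (simp add: zero_le_mult_iff)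
    qed
    have high: "?BR s 1" if s: "s \<in> {0..1}" and "s \<ge> sH" for s
    proof -
      have "a * (1 - s) + b * s \<le> 0" using lt[of s] that by auto
      \<comment> \<open>With \<open>a > 0\<close> the order is \<open>G(0, 1) <= G(0, 0)\<close>, so
        the sign at \<open>q = 1\<close> alone suffices.\<close>
      moreover have "a * (1 - s) * p2 \<le> a * (1 - s)"
        using a s p by (intro mult_left_le) auto
      ultimately show ?thesis by (intro BR1[OF s]) auto
    qed
    show "let sH = a / (a - b) in
            (\<forall>s\<in>{sL<..<sH}.
               (\<exists>!q. q \<in> {0..1} \<and> F V p1 p2 t1 t2 s q = 0) \<and>
               (\<forall>qd\<in>{0..1}. F V p1 p2 t1 t2 s qd = 0 \<longrightarrow> ?BR s qd)) \<and>
            (\<forall>s\<in>{0..1}. s \<le> sL \<longrightarrow> ?BR s 0) \<and>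
            (\<forall>s\<in>{0..1}. s \<ge> sH \<longrightarrow> ?BR s 1)"
      unfolding Let_def sH_def[symmetric] by (intro conjI ballI impI mid low high)
  qed
  show ?thesis
    unfolding a_def[symmetric] b_def[symmetric]
  proof (intro conjI)
    show "a \<ge> 0 \<and> b \<ge> 0 \<longrightarrow> (\<forall>s\<in>{0..1}. ?BR s 0)" using 1 by blast
    show "a \<le> 0 \<and> b \<le> 0 \<longrightarrow> (\<forall>s\<in>{0..1}. ?BR s 1)" using 2 by blast
    show "a < 0 \<and> 0 < b \<longrightarrow> (let s0 = - a / (b / p2 - a) in
        \<forall>s\<in>{0..1}. ?BR s (if s < s0 then 1 else 0))"
      unfolding Let_def by (intro impI ballI 3) auto
  qed (intro impI, elim conjE, rule 4)
qed

end
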